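(* Let $k\in\mathbb Z_{\ge0}$ and write $z=x+iy$. For all nonzero $z\in\mathbb C$ with $-1/2\leqslant x\leqslant 1/2$, $$\left| \cot^{(k)}(\pi z) \right| \leqslant \delta_{0,k}+ 20 \frac{k!}{\pi^{k+1}} \left(\frac 1{|z|^{k+1}}+ 8^{k+1} \right) e^{-\pi |y|}.$$ Also, for all $z\in\mathbb C$ with $|y|\geqslant1$, $$\left| \cot^{(k)}(\pi z) \right| \leqslant \delta_{0,k}+\frac{k!}{\pi^{k+1}} \left(\frac{4.01}{|y|} \right)^{k+1} e^{-\pi |y|}.$$
   Context: $\cot^{(k)}(\pi z)$ denotes the $k$-th derivative of $\cot$ evaluated at $\pi z$; $\delta_{0,k}$ is the Kronecker delta. *)

theory Defs
  imports "HOL-Complex_Analysis.Complex_Analysis"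
begin

end

theory Submission imports Defs begin

text \<open>
  Away from the real axis, \<open>cot w \<plusminus> \<i>\<close> is exponentially small, and Cauchy's inequality on a disc of
  radius \<open>\<bar>Im w\<bar> / 4\<close> bounds all derivatives. Close to the real axis, \<open>cot w - 1/w\<close> extends
  holomorphically over \<open>0\<close>; it is bounded on the square of half side \<open>3\<pi>/4\<close> by the maximum modulus
  principle (on the vertical sides \<open>\<bar>cot w\<bar> = 1\<close>), and Cauchy's inequality on discs of radius \<open>\<pi>/4\<close>
  applies, while the derivatives of \<open>1/w\<close> are explicit.
\<close>

section \<open>Derivatives of the reciprocal and zeros of sine\<close>

lemma higher_deriv_inverse:
  fixes w :: complex
  assumes "w \<noteq> 0"
  shows "(deriv ^^ k) (\<lambda>x. 1 / x) w = (-1) ^ k * fact k / w ^ Suc k"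
  using assms
proof (induction k arbitrary: w)
  case (Suc k)
  have "(deriv ^^ Suc k) (\<lambda>x. 1 / x) w = deriv (\<lambda>w. (-1) ^ k * fact k / w ^ Suc k) w"
    unfolding funpow.simps o_def
  proof (rule deriv_cong_ev)
    show "\<forall>\<^sub>F x in nhds w. (deriv ^^ k) (\<lambda>x. 1 / x) x = (-1) ^ k * fact k / x ^ Suc k"
      using t1_space_nhds[OF Suc.prems] by eventually_elim (rule Suc.IH)
  qed simp
  also have "\<dots> = (-1) ^ Suc k * fact (Suc k) / w ^ Suc (Suc k)"
  proof (rule DERIV_imp_deriv)
    have "((\<lambda>w. (-1) ^ k * fact k / w ^ Suc k) has_field_derivative
        - ((-1) ^ k * fact k * (of_nat (Suc k) * w ^ k)) / (w ^ Suc k * w ^ Suc k)) (at w)"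
      using Suc.prems by (auto intro!: derivative_eq_intros simp del: power_Suc of_nat_Suc)
    also have "- ((-1) ^ k * fact k * (of_nat (Suc k) * w ^ k)) / (w ^ Suc k * w ^ Suc k)
        = (-1) ^ Suc k * fact (Suc k) / w ^ Suc (Suc k)"
      using Suc.prems by (simp add: field_simps)
    finally show "((\<lambda>w. (-1) ^ k * fact k / w ^ Suc k) has_field_derivative
        (-1) ^ Suc k * fact (Suc k) / w ^ Suc (Suc k)) (at w)" .
  qed
  finally show ?case .
qed simp

lemma sin_nonzero_off_axis:
  fixes w :: complex
  assumes "Im w \<noteq> 0"
  shows "sin w \<noteq> 0"
  using assms by (auto simp: sin_eq_0)

lemma sin_nonzero_strip:
  fixes w :: complex
  assumes "w \<noteq> 0" "\<bar>Re w\<bar> < pi"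
  shows "sin w \<noteq> 0"
proof
  assume "sin w = 0"
  then obtain n :: int where n: "w = of_real (n * pi)"
    by (auto simp: sin_eq_0)
  with assms have "\<bar>real_of_int n\<bar> * pi < 1 * pi"
    by (simp add: abs_mult)
  then have "\<bar>real_of_int n\<bar> < 1"
    by (subst (asm) mult_less_cancel_right_pos) auto
  then have "n = 0"
    by linarith
  with n assms show False
    by simp
qed

section \<open>Exponential decay away from the real axis\<close>

lemma norm_cot_plus_ii_le:
  fixes w :: complex
  assumes "0 < Im w"
  shows "norm (cot w + \<i>) \<le> 2 * exp (- 2 * Im w) / (1 - exp (- 2 * Im w))"
proof -
  \<comment> \<open>In terms of \<open>q\<close> the function \<open>cot w + \<i>\<close> becomes
    2iq/(q - 1), and |q| < 1 in the upper half plane, so its size is governed by |q| alone.\<close>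
  define q where "q = exp (2 * \<i> * w)"
  have nq: "norm q = exp (- 2 * Im w)"
    by (simp add: q_def)
  then have lt: "norm q < 1"
    using assms by simp
  then have q1: "q \<noteq> 1"
    by auto
  define E where "E = exp (- (\<i> * w))"
  have E: "E \<noteq> 0" "exp (\<i> * w) = q * E"
    by (simp_all add: q_def E_def flip: exp_add)
  have "sin w = (q - 1) * E / (2 * \<i>)" "cos w = (q + 1) * E / 2"
    unfolding sin_exp_eq cos_exp_eq E(2) E_def[symmetric] by (simp_all add: algebra_simps)
  then have "cot w + \<i> = ((q + 1) * E / 2) / ((q - 1) * E / (2 * \<i>)) + \<i>"
    by (simp only: cot_def)
  also have "\<dots> = \<i> * (2 * q) / (q - 1)"
    using q1 E(1) by (simp add: divide_simps)
  finally have "cot w + \<i> = \<i> * (2 * q) / (q - 1)" .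
  then have "norm (cot w + \<i>) = norm (\<i> * (2 * q) / (q - 1))"
    by (simp only:)
  also have "\<dots> = 2 * norm q / norm (1 - q)"
    by (simp add: norm_mult norm_divide norm_minus_commute)
  also have "\<dots> \<le> 2 * norm q / (1 - norm q)"
    using lt norm_triangle_ineq2[of 1 q] by (intro frac_le) auto
  finally show ?thesis
    unfolding nq .
qed

text \<open>Since \<open>cot\<close> is odd, the lower half plane reduces to the upper one through w
  -> -w; the limit of \<open>cot\<close> at infinity changes sign accordingly.\<close>

lemma norm_cot_plus_sgn_ii_le:
  fixes w :: complex
  assumes "Im w \<noteq> 0"
  shows "norm (cot w + sgn (Im w) * \<i>) \<le> 2 * exp (- 2 * \<bar>Im w\<bar>) / (1 - exp (- 2 * \<bar>Im w\<bar>))"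
proof (cases "Im w > 0")
  case True
  then show ?thesis
    using norm_cot_plus_ii_le[of w] by simp
next
  case False
  then have "norm (cot w + sgn (Im w) * \<i>) = norm (cot (- w) + \<i>)"
    using assms norm_minus_cancel[of "cot w - \<i>"] by (simp add: algebra_simps)
  then show ?thesis
    using norm_cot_plus_ii_le[of "- w"] False assms by simp
qed

text \<open>On the disc of radius |Im w|/4 the imaginary part stays at least 3/4 of |Im w| in
  modulus, so the decay rate 2 becomes 2 * 3/4 = 3/2. This is faster than the rate 1 wanted in the
  theorem; the surplus is spent there.\<close>

lemma norm_higher_deriv_cot_le_off_axis:
  fixes w :: complex
  assumes Y: "\<bar>Im w\<bar> \<ge> pi / 2"
  shows "norm ((deriv ^^ k) cot w)
    \<le> of_bool (k = 0) + fact k * (4 * exp (- (3 / 2) * \<bar>Im w\<bar>)) / (\<bar>Im w\<bar> / 4) ^ k"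
proof -
  define Y where "Y = \<bar>Im w\<bar>"
  define c where "c = complex_of_real (sgn (Im w)) * \<i>"
  have Y2: "Y \<ge> pi / 2" "Y > 1"
    using Y pi_gt3 by (auto simp: Y_def)
  define S where "S = cball w (Y / 4)"
  \<comment> \<open>The disc does not meet the real axis, so \<open>sgn (Im x)\<close> is constant
    on it and \<open>c\<close> is the right constant to add at every point of the disc.\<close>
  have im: "\<bar>Im x\<bar> \<ge> 3 / 4 * Y \<and> sgn (Im x) = sgn (Im w)" if "x \<in> S" for x
    using that abs_Im_le_cmod[of "w - x"] Y2
    by (auto simp: S_def dist_norm Y_def sgn_if abs_if split: if_splits)
  have sin: "sin x \<noteq> 0" if "x \<in> S" for x
    using im[OF that] Y2 by (intro sin_nonzero_off_axis) auto
  have wS: "w \<in> S"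
    using Y2 by (simp add: S_def)
  have an: "cot analytic_on {w}"
    using sin[OF wS] by (intro analytic_intros) auto
  have hol: "(\<lambda>x. cot x + c) analytic_on S"
    using sin by (intro analytic_intros) auto
  have "norm ((deriv ^^ k) (\<lambda>x. cot x + c) w) \<le> fact k * (4 * exp (- (3 / 2) * Y)) / (Y / 4) ^ k"
  proof (rule Cauchy_inequality)
    show "(\<lambda>x. cot x + c) holomorphic_on ball w (Y / 4)"
      using analytic_imp_holomorphic[OF hol] by (rule holomorphic_on_subset) (auto simp: S_def)
    show "continuous_on (cball w (Y / 4)) (\<lambda>x. cot x + c)"
      using analytic_imp_holomorphic[OF hol] holomorphic_on_imp_continuous_on by (simp add: S_def)
    show "norm (cot x + c) \<le> 4 * exp (- (3 / 2) * Y)" if "norm (w - x) = Y / 4" for x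
    proof -
      have x: "x \<in> S"
        using that by (simp add: S_def dist_norm)
      have e1: "exp (- 2 * \<bar>Im x\<bar>) \<le> exp (- (3 / 2) * Y)"
        using im[OF x] by simp
      \<comment> \<open>This makes the denominator at least 1/2, whence the constant 4 = 2 /
        (1/2).\<close>
      have "exp (1::real) \<le> exp (3 / 2 * Y)"
        using Y2 by simp
      then have "2 \<le> exp (3 / 2 * Y)"
        using exp_ge_add_one_self[of 1] by linarith
      then have e2: "exp (- (3 / 2) * Y) \<le> 1 / 2"
        by (simp add: exp_minus field_simps)
      have "norm (cot x + c) \<le> 2 * exp (- 2 * \<bar>Im x\<bar>) / (1 - exp (- 2 * \<bar>Im x\<bar>))"
        using norm_cot_plus_sgn_ii_le[of x] im[OF x] Y2 by (auto simp: c_def)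
      also have "\<dots> \<le> 2 * exp (- (3 / 2) * Y) / (1 / 2)"
      proof (intro frac_le)
        show "1 / 2 \<le> 1 - exp (- 2 * \<bar>Im x\<bar>)"
          using e1 e2 by linarith
      qed (use e1 in auto)
      finally show ?thesis
        by simp
    qed
  qed (use Y2 in auto)
  \<comment> \<open>The constant \<open>c\<close> survives only in the derivative of order 0; as |c|
    = 1, it is the source of the Kronecker delta.\<close>
  moreover have "(deriv ^^ k) (\<lambda>x. cot x + c) w = (deriv ^^ k) cot w + (if k = 0 then c else 0)"
    using an by (subst higher_deriv_add_at) (auto simp: analytic_on_const)
  moreover have "norm (if k = 0 then c else 0) \<le> of_bool (k = 0)"
    by (simp add: c_def norm_mult sgn_if)
  moreover have "norm ((deriv ^^ k) cot w)
      \<le> norm ((deriv ^^ k) cot w + (if k = 0 then c else 0)) + norm (if k = 0 then c else 0)"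
    by (metis add_diff_cancel_right' norm_triangle_ineq4)
  ultimately have "norm ((deriv ^^ k) cot w)
      \<le> of_bool (k = 0) + fact k * (4 * exp (- (3 / 2) * Y)) / (Y / 4) ^ k"
    by (smt (verit))
  then show ?thesis
    unfolding Y_def .
qed

section \<open>Removal of the pole at 0 and bounds near the real axis\<close>

lemma open_Re_strip: "open {w. \<bar>Re w\<bar> < c}"
proof -
  have "{w. \<bar>Re w\<bar> < c} = {w. - c < Re w} \<inter> {w. Re w < c}"
    by auto
  then show ?thesis
    by (auto intro: open_Int open_halfspace_Re_gt open_halfspace_Re_lt)
qed

text \<open>After its singularity at 0 is filled with the value 1, sin w / w has no zero in the
  strip. Hence w * cot w extends holomorphically with value 1 at 0, so the pole of
  \<open>cot\<close> there is simple with residue 1, and subtracting 1/w removes it.\<close>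

lemma cot_minus_inverse_holomorphic:
  defines "S \<equiv> {w. \<bar>Re w\<bar> < pi}"
  obtains f :: "complex \<Rightarrow> complex" where "f holomorphic_on S" "\<And>w. w \<noteq> 0 \<Longrightarrow> f w = cot w - 1 / w"
proof -
  have S: "open S"
    unfolding S_def by (rule open_Re_strip)
  define s :: "complex \<Rightarrow> complex" where "s = (\<lambda>w. if w = 0 then 1 else sin w / w)"
  have "deriv sin (0::complex) = 1"
    by (rule DERIV_imp_deriv) (auto intro!: derivative_eq_intros)
  then have "s holomorphic_on S"
    using pole_lemma_open[of sin S 0, OF holomorphic_on_sin S]
    by (simp add: s_def cong: if_cong)
  moreover have "s w \<noteq> 0" if "w \<in> S" for w
    using that sin_nonzero_strip[of w] by (auto simp: s_def S_def)
  ultimately have g: "(\<lambda>w. cos w / s w) holomorphic_on S"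
    by (intro holomorphic_intros)
  have "(\<lambda>z. if z = 0 then deriv (\<lambda>w. cos w / s w) 0 else cot z - (cos 0 / s 0) / (z - 0))
      holomorphic_on S"
    by (rule pole_theorem_open[OF g S]) (auto simp: s_def cot_def)
  then show ?thesis
    by (rule that) (simp add: s_def)
qed

text \<open>The difference of |cos w|^2 and |sin w|^2 is cos (2 Re w), which vanishes on these
  lines.\<close>

lemma norm_cot_vertical:
  fixes w :: complex
  assumes "\<bar>Re w\<bar> = 3 * pi / 4"
  shows "norm (cot w) \<le> 1"
proof -
  have c: "cos (2 * Re w) = 0"
  proof -
    have "cos (2 * Re w) = cos (2 * \<bar>Re w\<bar>)"
      by (simp add: abs_if)
    also have "2 * \<bar>Re w\<bar> = pi + pi / 2"
      using assms by simp
    also have "cos (pi + pi / 2) = 0"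
      unfolding cos_add by simp
    finally show ?thesis .
  qed
  then have "(cos (Re w))\<^sup>2 = 1 / 2"
    by (simp add: cos_double_cos)
  with c have "(norm (cos w))\<^sup>2 = (norm (sin w))\<^sup>2"
    unfolding norm_cos_squared norm_sin_squared exp_double
    by (simp add: power2_diff power_inverse) (simp add: field_simps)
  then have "norm (cos w) = norm (sin w)"
    by simp
  then show ?thesis
    by (simp add: cot_def norm_divide)
qed

lemma norm_cot_horizontal:
  fixes w :: complex
  assumes "\<bar>Im w\<bar> = 3 * pi / 4"
  shows "norm (cot w) \<le> 5 / 3"
proof -
  let ?q = "exp (- 2 * \<bar>Im w\<bar>)"
  have nz: "Im w \<noteq> 0"
    using assms by auto
  have "4 \<le> exp (2 * \<bar>Im w\<bar>)"
    using exp_ge_add_one_self[of "2 * \<bar>Im w\<bar>"] assms pi_gt3 by linarith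
  then have q: "?q \<le> 1 / 4"
    by (simp add: exp_minus field_simps)
  have "norm (cot w) \<le> norm (cot w + sgn (Im w) * \<i>) + norm (sgn (Im w) * \<i>)"
    using norm_triangle_ineq4[of "cot w + sgn (Im w) * \<i>" "sgn (Im w) * \<i>"] by simp
  also have "norm (sgn (Im w) * \<i>) = 1"
    using nz by (simp add: norm_mult sgn_if)
  also have "norm (cot w + sgn (Im w) * \<i>) \<le> 2 * ?q / (1 - ?q)"
    by (rule norm_cot_plus_sgn_ii_le[OF nz])
  \<comment> \<open>The sum is 1 + 2/3 = 5/3.\<close>
  also have "\<dots> \<le> 2 * (1 / 4) / (1 - 1 / 4)"
    using q by (intro frac_le) auto
  finally show ?thesis
    by simp
qed

text \<open>The half side 3 pi/4 = pi/2 + pi/4 lets the square contain every disc of radius pi/4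
  around an admissible \<open>w\<close>, while it still avoids the poles at pi and -pi.\<close>

lemma norm_higher_deriv_cot_le_near_axis:
  fixes w :: complex
  assumes w: "w \<noteq> 0" "\<bar>Re w\<bar> \<le> pi / 2" "\<bar>Im w\<bar> \<le> pi / 2"
  shows "norm ((deriv ^^ k) cot w) \<le> fact k * (1 / norm w ^ (k + 1) + (8 / pi) ^ (k + 1))"
proof -
  define S where "S = {w. \<bar>Re w\<bar> < pi}"
  obtain f where f: "f holomorphic_on S" "\<And>w. w \<noteq> 0 \<Longrightarrow> f w = cot w - 1 / w"
    using cot_minus_inverse_holomorphic unfolding S_def by blast
  define p where "p = Complex (3 * pi / 4) (3 * pi / 4)"
  define Q where "Q = cbox (- p) p"
  have Q: "x \<in> Q \<longleftrightarrow> \<bar>Re x\<bar> \<le> 3 * pi / 4 \<and> \<bar>Im x\<bar> \<le> 3 * pi / 4" for x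
    by (auto simp: Q_def p_def in_cbox_complex_iff)
  have QS: "Q \<subseteq> S"
    using pi_gt_zero by (auto simp: Q S_def simp del: pi_gt_zero)
  have bound: "norm (f x) \<le> 8 / pi" if x: "x \<in> Q" for x
  proof (rule maximum_modulus_frontier[of f Q])
    show "f holomorphic_on interior Q"
      using f(1) QS interior_subset holomorphic_on_subset by blast
    show "continuous_on (closure Q) f"
      using holomorphic_on_imp_continuous_on[OF f(1)] QS continuous_on_subset
      by (auto simp: Q_def)
    show "bounded Q"
      by (simp add: Q_def)
    fix y assume "y \<in> frontier Q"
    then have y: "\<bar>Re y\<bar> = 3 * pi / 4 \<or> \<bar>Im y\<bar> = 3 * pi / 4"
      by (auto simp: Q_def frontier_cbox in_cbox_complex_iff in_box_complex_iff p_def)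
    have ny: "norm y \<ge> 3 * pi / 4"
      using y abs_Re_le_cmod[of y] abs_Im_le_cmod[of y] by auto
    then have "y \<noteq> 0"
      using pi_gt_zero by (auto simp del: pi_gt_zero)
    then have "norm (f y) \<le> norm (cot y) + 1 / norm y"
      using norm_triangle_ineq4[of "cot y" "1 / y"] by (simp add: f(2) norm_divide)
    also have "norm (cot y) \<le> 5 / 3"
      using y norm_cot_vertical[of y] norm_cot_horizontal[of y] by auto
    also have "1 / norm y \<le> 1 / (3 * pi / 4)"
      using ny by (intro frac_le) auto
    \<comment> \<open>After clearing denominators this is just pi \<le> 4.\<close>
    also have "5 / 3 + 1 / (3 * pi / 4) \<le> 8 / pi"
      using pi_approx by (simp add: field_simps)
    finally show "norm (f y) \<le> 8 / pi"
      by simp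
  qed (rule x)
  have ball: "cball w (pi / 4) \<subseteq> Q"
  proof
    fix x assume "x \<in> cball w (pi / 4)"
    then show "x \<in> Q"
      using w abs_Im_le_cmod[of "w - x"] abs_Re_le_cmod[of "w - x"]
      by (auto simp: Q dist_norm)
  qed
  have "w \<in> Q"
    using ball by auto
  then have wS: "w \<in> S"
    using QS by blast
  have oS: "open S"
    unfolding S_def by (rule open_Re_strip)
  have "norm ((deriv ^^ k) f w) \<le> fact k * (8 / pi) / (pi / 4) ^ k"
  proof (rule Cauchy_inequality)
    show "f holomorphic_on ball w (pi / 4)"
      using f(1) ball QS ball_subset_cball by (meson holomorphic_on_subset subset_trans)
    show "continuous_on (cball w (pi / 4)) f"
      using holomorphic_on_imp_continuous_on[OF f(1)] ball QS
      by (meson continuous_on_subset subset_trans)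
    show "norm (f x) \<le> 8 / pi" if "norm (w - x) = pi / 4" for x
      using that ball by (intro bound) (auto simp: dist_norm)
  qed simp
  \<comment> \<open>Cauchy's inequality gives powers of 4/pi; they are relaxed to 8/pi so that all k
    + 1 factors agree.\<close>
  also have "\<dots> \<le> fact k * (8 / pi) ^ (k + 1)"
  proof -
    have "fact k * (8 / pi) / (pi / 4) ^ k = fact k * ((8 / pi) * (4 / pi) ^ k)"
      by (simp add: power_divide)
    also have "\<dots> \<le> fact k * ((8 / pi) * (8 / pi) ^ k)"
      by (intro mult_left_mono power_mono divide_right_mono) auto
    finally show ?thesis
      by simp
  qed
  finally have fk: "norm ((deriv ^^ k) f w) \<le> fact k * (8 / pi) ^ (k + 1)" .
  \<comment> \<open>The two functions agree only off 0, so derivatives are compared on the punctured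
    strip, an open set containing \<open>w\<close>.\<close>
  have "(deriv ^^ k) cot w = (deriv ^^ k) (\<lambda>x. f x + 1 / x) w"
  proof (rule higher_deriv_transform_within_open)
    show "cot holomorphic_on (S - {0})"
      using sin_nonzero_strip
      by (intro analytic_imp_holomorphic analytic_intros) (auto simp: S_def)
    show "(\<lambda>x. f x + 1 / x) holomorphic_on (S - {0})"
      using f(1) by (auto intro!: holomorphic_intros intro: holomorphic_on_subset)
  qed (use f(2) oS wS w in auto)
  also have "\<dots> = (deriv ^^ k) f w + (deriv ^^ k) (\<lambda>x. 1 / x) w"
  proof (rule higher_deriv_add_at)
    show "f analytic_on {w}"
      using f(1) oS wS analytic_at by blast
    show "(\<lambda>x. 1 / x) analytic_on {w}"
      using w by (auto intro!: analytic_intros)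
  qed
  finally have "norm ((deriv ^^ k) cot w)
      \<le> norm ((deriv ^^ k) f w) + norm ((deriv ^^ k) (\<lambda>x. 1 / x) w)"
    using norm_triangle_ineq by metis
  also have "norm ((deriv ^^ k) (\<lambda>x. 1 / x) w) = fact k * (1 / norm w ^ (k + 1))"
    using w by (simp add: higher_deriv_inverse norm_mult norm_divide norm_power)
  finally show ?thesis
    using fk by (simp add: algebra_simps)
qed

text \<open>From (1 - x/4)^2 \<ge> 0 follows x \<le> (1 + x/4)^2, and 1 + x/4 \<le> exp (x/4). In
  the second estimate this lets half a unit of exponential rate absorb a factor |Im w|.\<close>

lemma exp_half_ge_self:
  fixes x :: real
  assumes "0 \<le> x"
  shows "x \<le> exp (x / 2)"
proof -
  have "0 \<le> (1 - x / 4)\<^sup>2"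
    by simp
  then have "x \<le> (1 + x / 4)\<^sup>2"
    by (simp add: power2_eq_square algebra_simps)
  also have "\<dots> \<le> (exp (x / 4))\<^sup>2"
    using assms by (intro power_mono) auto
  also have "\<dots> = exp (x / 2)"
    by (simp flip: exp_double)
  finally show ?thesis .
qed

section \<open>The two estimates, via the substitution w = pi z\<close>

theorem theorem3p3:
  fixes k :: nat
  shows "(\<forall>z::complex. z \<noteq> 0 \<longrightarrow> - 1 / 2 \<le> Re z \<longrightarrow> Re z \<le> 1 / 2 \<longrightarrow>
            norm ((deriv ^^ k) cot (of_real pi * z))
              \<le> of_bool (k = 0)
                + 20 * (fact k / pi ^ (k + 1)) * (1 / norm z ^ (k + 1) + 8 ^ (k + 1))
                    * exp (- pi * \<bar>Im z\<bar>))
       \<and> (\<forall>z::complex. \<bar>Im z\<bar> \<ge> 1 \<longrightarrow>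
            norm ((deriv ^^ k) cot (of_real pi * z))
              \<le> of_bool (k = 0)
                + fact k / pi ^ (k + 1) * (4.01 / \<bar>Im z\<bar>) ^ (k + 1)
                    * exp (- pi * \<bar>Im z\<bar>))"
proof (intro conjI allI impI)
  fix z :: complex
  assume z: "z \<noteq> 0" "- 1 / 2 \<le> Re z" "Re z \<le> 1 / 2"
  define w where "w = of_real pi * z"
  define y where "y = \<bar>Im z\<bar>"
  have imw: "\<bar>Im w\<bar> = pi * y"
    by (simp add: w_def y_def abs_mult)
  have nw: "norm w = pi * norm z"
    by (simp add: w_def norm_mult)
  let ?A = "fact k / pi ^ (k + 1) * (1 / norm z ^ (k + 1) + 8 ^ (k + 1))"
  have A: "?A \<ge> 0"
    by simp
  have "norm ((deriv ^^ k) cot w) \<le> of_bool (k = 0) + 20 * ?A * exp (- pi * y)"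
  \<comment> \<open>The threshold 1/2 corresponds to |Im w| = pi/2, where the near-axis and off-axis
    bounds meet.\<close>
  proof (cases "y \<le> 1 / 2")
    case True
    have "pi * \<bar>Re z\<bar> \<le> pi * (1 / 2)"
      using z by (intro mult_left_mono) auto
    then have "\<bar>Re w\<bar> \<le> pi / 2"
      by (simp add: w_def abs_mult)
    moreover have "\<bar>Im w\<bar> \<le> pi / 2"
      using True imw mult_left_mono[of y "1 / 2" pi] by simp
    ultimately have "norm ((deriv ^^ k) cot w)
        \<le> fact k * (1 / norm w ^ (k + 1) + (8 / pi) ^ (k + 1))"
      using z by (intro norm_higher_deriv_cot_le_near_axis) (auto simp: w_def)
    also have "\<dots> = ?A * 1"
      by (simp add: nw power_mult_distrib power_divide distrib_left)
    also have "\<dots> \<le> ?A * (20 * exp (- pi * y))"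
    proof (rule mult_left_mono[OF _ A])
      \<comment> \<open>Near the axis the factor exp (-pi y) costs at most exp 2 \<le> 9, which the
        constant 20 covers.\<close>
      have "exp (pi * y) \<le> exp (2::real)"
        using \<open>\<bar>Im w\<bar> \<le> pi / 2\<close> imw pi_less_4 unfolding exp_le_cancel_iff by linarith
      also have "\<dots> = (exp (1::real))\<^sup>2"
        by (simp flip: exp_double)
      also have "\<dots> \<le> 3\<^sup>2"
        using exp_le by (intro power_mono) auto
      finally show "1 \<le> 20 * exp (- pi * y)"
        by (simp add: exp_minus field_simps)
    qed
    also have "\<dots> = 20 * ?A * exp (- pi * y)"
      by (simp only: mult_ac)
    also have "\<dots> \<le> of_bool (k = 0) + 20 * ?A * exp (- pi * y)"
      by (rule add_increasing) auto
    finally show ?thesis .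
  next
    case False
    have py: "0 < pi * y" "pi / 2 \<le> pi * y"
      using False mult_left_mono[of "1 / 2" y pi] by auto
    have "norm ((deriv ^^ k) cot w)
        \<le> of_bool (k = 0) + fact k * (4 * exp (- (3 / 2) * \<bar>Im w\<bar>)) / (\<bar>Im w\<bar> / 4) ^ k"
      using py imw by (intro norm_higher_deriv_cot_le_off_axis) auto
    also have "fact k * (4 * exp (- (3 / 2) * \<bar>Im w\<bar>)) / (\<bar>Im w\<bar> / 4) ^ k
        = fact k * (4 / pi ^ k * (4 / y) ^ k) * exp (- (3 / 2) * (pi * y))"
      by (simp add: imw power_mult_distrib power_divide)
    \<comment> \<open>Here the term 8^(k+1) alone suffices: k factors 8 come from 4/y \<le> 8, and
      the last 8/pi is absorbed by 4 \<le> 160/pi.\<close>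
    also have "\<dots> \<le> fact k * (20 * 8 / pi / pi ^ k * 8 ^ k) * exp (- pi * y)"
    proof (intro mult_mono mult_left_mono divide_right_mono power_mono)
      show "4 \<le> 20 * 8 / pi"
        using pi_less_4 by (simp add: field_simps)
      show "4 / y \<le> 8"
        using False by (simp add: field_simps)
      show "exp (- (3 / 2) * (pi * y)) \<le> exp (- pi * y)"
        using py by simp
    qed (use False in auto)
    also have "\<dots> = 20 * (fact k / pi ^ (k + 1) * (0 + 8 ^ (k + 1))) * exp (- pi * y)"
      by (simp add: field_simps)
    also have "\<dots> \<le> 20 * ?A * exp (- pi * y)"
      by (intro mult_right_mono mult_left_mono add_right_mono) auto
    finally show ?thesis
      by simp
  qed
  then show "norm ((deriv ^^ k) cot (of_real pi * z)) \<le> of_bool (k = 0)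
      + 20 * (fact k / pi ^ (k + 1)) * (1 / norm z ^ (k + 1) + 8 ^ (k + 1)) * exp (- pi * \<bar>Im z\<bar>)"
    by (simp add: w_def y_def mult.assoc)
next
  fix z :: complex
  assume z: "\<bar>Im z\<bar> \<ge> 1"
  define w where "w = of_real pi * z"
  define Y where "Y = \<bar>Im w\<bar>"
  have Y: "Y = pi * \<bar>Im z\<bar>"
    by (simp add: Y_def w_def abs_mult)
  have Y2: "pi / 2 \<le> Y" "0 < Y"
    using z mult_left_mono[of 1 "\<bar>Im z\<bar>" pi] pi_gt_zero unfolding Y by (auto simp del: pi_gt_zero)
  have "norm ((deriv ^^ k) cot w)
      \<le> of_bool (k = 0) + fact k * (4 * exp (- (3 / 2) * Y)) / (Y / 4) ^ k"
    unfolding Y_def using Y2 by (intro norm_higher_deriv_cot_le_off_axis) (auto simp: Y_def)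
  \<comment> \<open>The Cauchy bound carries only k factors 4/Y. The missing one is created by
    writing 4 = (4/Y) * Y, and the new factor Y is paired with exp (-Y/2), leaving exp (-Y).\<close>
  also have "fact k * (4 * exp (- (3 / 2) * Y)) / (Y / 4) ^ k
      = fact k * (4 / Y) ^ k * (4 / Y) * (Y * exp (- Y / 2)) * exp (- Y)"
  proof -
    have "exp (- (3 / 2) * Y) = exp (- Y / 2) * exp (- Y)"
      by (simp flip: exp_add)
    then show ?thesis
      using Y2 by (simp add: power_divide)
  qed
  also have "\<dots> \<le> fact k * (4.01 / Y) ^ k * (4.01 / Y) * 1 * exp (- Y)"
  proof (intro mult_right_mono mult_mono power_mono divide_right_mono)
    show "Y * exp (- Y / 2) \<le> 1"
      using exp_half_ge_self[of Y] Y2 by (simp add: exp_minus field_simps)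
  qed (use Y2 in auto)
  also have "\<dots> = fact k / pi ^ (k + 1) * (4.01 / \<bar>Im z\<bar>) ^ (k + 1) * exp (- pi * \<bar>Im z\<bar>)"
    unfolding Y by (simp add: power_divide power_mult_distrib mult_ac)
  finally show "norm ((deriv ^^ k) cot (of_real pi * z)) \<le> of_bool (k = 0)
      + fact k / pi ^ (k + 1) * (4.01 / \<bar>Im z\<bar>) ^ (k + 1) * exp (- pi * \<bar>Im z\<bar>)"
    by (simp add: w_def)
qed

end
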